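(* The ideal $\mathcal{ED}_{\mathrm{fin}}$ on $\Delta=\{(n,m)\in\omega\times\omega: m\le n\}$ contains no cotowers.
   Context: $A\subseteq^* B$ means that $A\setminus B$ is finite. Ideals on a countably infinite set $\Omega$ are assumed to be proper and to contain all finite subsets of $\Omega$. A tower on $\Omega$ is a sequence $(T_\alpha)_{\alpha<\kappa}$ of infinite subsets of $\Omega$, with $\kappa$ a cardinal, such that $T_\beta\subseteq^* T_\alpha$ whenever $\alpha\le\beta<\kappa$, and which has no pseudointersection, i.e. there is no infinite $X\subseteq\Omega$ with $X\subseteq^* T_\alpha$ for all $\alpha<\kappa$. A cotower in an ideal $\mathcal{I}$ on $\Omega$ is a sequence $(A_\alpha)_{\alpha<\kappa}$ of elements of $\mathcal{I}$ such that $(\Omega\setminus A_\alpha)_{\alpha<\kappa}$ is a tower. For $A\subseteq\omega\times\omega$ let $(A)_n=\{k\in\omega:(n,k)\in A\}$. Then $\mathcal{ED}=\{A\subseteq\omega\times\omega:\limsup_{n\to\infty}|(A)_n|<\infty\}$ and $\mathcal{ED}_{\mathrm{fin}}=\{A\in\mathcal{ED}:A\subseteq\Delta\}$, an ideal on $\Delta$. *)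

theory Defs
  imports Main "HOL-Library.Extended_Nat" "HOL-Library.Liminf_Limsup"
begin

definition almost_subset :: "'a set \<Rightarrow> 'a set \<Rightarrow> bool"  (infix "\<subseteq>*" 50)
  where "A \<subseteq>* B \<longleftrightarrow> finite (A - B)"

definition ideal_on :: "'a set \<Rightarrow> 'a set set \<Rightarrow> bool"
  where "ideal_on \<Omega> I \<longleftrightarrow>
    I \<subseteq> Pow \<Omega> \<and>
    (\<forall>A\<in>I. \<forall>B. B \<subseteq> A \<longrightarrow> B \<in> I) \<and>
    (\<forall>A\<in>I. \<forall>B\<in>I. A \<union> B \<in> I) \<and>
    (\<forall>F. F \<subseteq> \<Omega> \<and> finite F \<longrightarrow> F \<in> I) \<and>
    \<Omega> \<notin> I"

definition pseudointersection :: "'a set \<Rightarrow> 'k rel \<Rightarrow> ('k \<Rightarrow> 'a set) \<Rightarrow> 'a set \<Rightarrow> bool"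
  where "pseudointersection \<Omega> \<kappa> T X \<longleftrightarrow>
    X \<subseteq> \<Omega> \<and> infinite X \<and> (\<forall>\<alpha>\<in>Field \<kappa>. X \<subseteq>* T \<alpha>)"

text \<open>
  A cardinal is a cardinal order \<open>\<kappa>\<close> on a subset of an arbitrary type: the ordinals below it
  are the elements of \<open>Field \<kappa>\<close>, and \<open>(\<alpha>, \<beta>) \<in> \<kappa>\<close> says that \<open>\<alpha> \<le> \<beta>\<close>.
  The values of a sequence outside \<open>Field \<kappa>\<close> are irrelevant.
\<close>

definition tower :: "'a set \<Rightarrow> 'k rel \<Rightarrow> ('k \<Rightarrow> 'a set) \<Rightarrow> bool"
  where "tower \<Omega> \<kappa> T \<longleftrightarrow>
    Card_order \<kappa> \<and>
    (\<forall>\<alpha>\<in>Field \<kappa>. T \<alpha> \<subseteq> \<Omega> \<and> infinite (T \<alpha>)) \<and>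
    (\<forall>\<alpha> \<beta>. (\<alpha>, \<beta>) \<in> \<kappa> \<longrightarrow> T \<beta> \<subseteq>* T \<alpha>) \<and>
    \<not> (\<exists>X. pseudointersection \<Omega> \<kappa> T X)"

definition cotower :: "'a set \<Rightarrow> 'a set set \<Rightarrow> 'k rel \<Rightarrow> ('k \<Rightarrow> 'a set) \<Rightarrow> bool"
  where "cotower \<Omega> I \<kappa> A \<longleftrightarrow>
    (\<forall>\<alpha>\<in>Field \<kappa>. A \<alpha> \<in> I) \<and> tower \<Omega> \<kappa> (\<lambda>\<alpha>. \<Omega> - A \<alpha>)"

definition vsection :: "(nat \<times> nat) set \<Rightarrow> nat \<Rightarrow> nat set"
  where "vsection A n = {k. (n, k) \<in> A}"

text \<open>
  Finitely many vertical sections of a set in \<open>ED\<close> may be infinite, so the cardinality takes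
  values in \<^typ>\<open>enat\<close>; \<^const>\<open>card\<close> would count infinite sections as empty.
\<close>

definition ecard :: "'a set \<Rightarrow> enat"
  where "ecard A = (if finite A then enat (card A) else \<infinity>)"

definition ED :: "(nat \<times> nat) set set"
  where "ED = {A. limsup (\<lambda>n. ecard (vsection A n)) < \<infinity>}"

definition Delta :: "(nat \<times> nat) set"
  where "Delta = {(n, m). m \<le> n}"

definition ED_fin :: "(nat \<times> nat) set set"
  where "ED_fin = {A \<in> ED. A \<subseteq> Delta}"

lemma ED_iff:
  "A \<in> ED \<longleftrightarrow> (\<exists>N::nat. \<forall>\<^sub>F n in sequentially. ecard (vsection A n) \<le> enat N)"
proof
  assume "A \<in> ED"
  then obtain N where N: "limsup (\<lambda>n. ecard (vsection A n)) = enat N"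
    by (auto simp: ED_def)
  then have "limsup (\<lambda>n. ecard (vsection A n)) < enat (Suc N)" by simp
  then have "\<forall>\<^sub>F n in sequentially. ecard (vsection A n) < enat (Suc N)"
    by (rule Limsup_lessD)
  then show "\<exists>N::nat. \<forall>\<^sub>F n in sequentially. ecard (vsection A n) \<le> enat N"
    by (intro exI[of _ "Suc N"]) (auto elim: eventually_mono)
next
  assume "\<exists>N::nat. \<forall>\<^sub>F n in sequentially. ecard (vsection A n) \<le> enat N"
  then obtain N where "\<forall>\<^sub>F n in sequentially. ecard (vsection A n) \<le> enat N" by blast
  then have "limsup (\<lambda>n. ecard (vsection A n)) \<le> enat N" by (rule Limsup_bounded)
  also have "\<dots> < \<infinity>" by simp
  finally show "A \<in> ED" by (simp add: ED_def)
qed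

lemma ecard_mono: "A \<subseteq> B \<Longrightarrow> ecard A \<le> ecard B"
  by (auto simp: ecard_def card_mono finite_subset)

lemma ecard_Un_le: "ecard (A \<union> B) \<le> ecard A + ecard B"
  by (auto simp: ecard_def card_Un_le)

lemma ideal_ED_fin: "ideal_on Delta ED_fin"
  unfolding ideal_on_def
proof (intro conjI ballI allI impI)
  show "ED_fin \<subseteq> Pow Delta" by (auto simp: ED_fin_def)
next
  fix A B assume A: "A \<in> ED_fin" and BA: "B \<subseteq> A"
  obtain N where "\<forall>\<^sub>F n in sequentially. ecard (vsection A n) \<le> enat N"
    using A by (auto simp: ED_fin_def ED_iff)
  then have "\<forall>\<^sub>F n in sequentially. ecard (vsection B n) \<le> enat N"
  proof eventually_elim
    case (elim n)
    have "vsection B n \<subseteq> vsection A n" using BA by (auto simp: vsection_def)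
    then show ?case using elim by (blast intro: order_trans ecard_mono)
  qed
  then show "B \<in> ED_fin" using A BA by (auto simp: ED_fin_def ED_iff)
next
  fix A B assume A: "A \<in> ED_fin" and B: "B \<in> ED_fin"
  obtain M where M: "\<forall>\<^sub>F n in sequentially. ecard (vsection A n) \<le> enat M"
    using A by (auto simp: ED_fin_def ED_iff)
  obtain N where N: "\<forall>\<^sub>F n in sequentially. ecard (vsection B n) \<le> enat N"
    using B by (auto simp: ED_fin_def ED_iff)
  have "\<forall>\<^sub>F n in sequentially. ecard (vsection (A \<union> B) n) \<le> enat (M + N)"
    using M N
  proof eventually_elim
    case (elim n)
    have "vsection (A \<union> B) n = vsection A n \<union> vsection B n" by (auto simp: vsection_def)
    then have "ecard (vsection (A \<union> B) n) \<le> ecard (vsection A n) + ecard (vsection B n)"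
      by (simp add: ecard_Un_le)
    also have "\<dots> \<le> enat M + enat N" using elim by (rule add_mono)
    finally show ?case by simp
  qed
  then show "A \<union> B \<in> ED_fin" using A B by (auto simp: ED_fin_def ED_iff)
next
  fix F assume F: "F \<subseteq> Delta \<and> finite F"
  then have "finite (fst ` F)" by simp
  then obtain m where m: "\<forall>n\<in>fst ` F. n < m" by (meson finite_nat_set_iff_bounded)
  have "ecard (vsection F n) \<le> enat 0" if "n \<ge> m" for n
  proof -
    have "vsection F n = {}" using m that by (force simp: vsection_def)
    then show ?thesis by (simp add: ecard_def)
  qed
  then have "\<forall>\<^sub>F n in sequentially. ecard (vsection F n) \<le> enat 0"
    using eventually_sequentially by blast
  then show "F \<in> ED_fin" using F by (auto simp: ED_fin_def ED_iff)
next
  show "Delta \<notin> ED_fin"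
  proof
    assume "Delta \<in> ED_fin"
    then obtain N where "\<forall>\<^sub>F n in sequentially. ecard (vsection Delta n) \<le> enat N"
      by (auto simp: ED_fin_def ED_iff)
    then obtain m where m: "\<And>n. n \<ge> m \<Longrightarrow> ecard (vsection Delta n) \<le> enat N"
      by (auto simp: eventually_sequentially)
    have "vsection Delta n = {..n}" for n by (auto simp: vsection_def Delta_def)
    then show False using m[of "max m N"] by (simp add: ecard_def)
  qed
qed

end

theory Submission
  imports Defs
begin

text \<open>
  Assign to \<open>A \<in> ED_fin\<close> the number \<open>r A = limsup |(A)\<^sub>n|\<close>, which is monotone under \<open>\<subseteq>*\<close>.
  If \<open>r\<close> is unbounded on a \<open>\<subseteq>*\<close>-chain, then sets of the chain of larger and larger rank are
  cofinal in it, and a diagonal argument applies. If \<open>r\<close> attains its maximum \<open>N\<close> at \<open>A\<close>, then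
  every larger member of the chain agrees with \<open>A\<close> in almost all of the infinitely many columns in
  which \<open>A\<close> has exactly \<open>N\<close> points. So the complement of \<open>A\<close> in these columns is almost
  disjoint from the whole chain.
\<close>

text \<open>This is the limsup \<open>r\<close> as a least eventual bound in \<open>nat\<close>. For
  subsets of \<open>Delta\<close> all columns are finite, so \<open>card\<close> agrees with
  \<open>ecard\<close>; without any eventual bound the value of \<open>LEAST\<close> is
  unspecified.\<close>

definition column_rank :: "(nat \<times> nat) set \<Rightarrow> nat"
  where "column_rank A = (LEAST N. \<forall>\<^sub>F n in sequentially. card (vsection A n) \<le> N)"

lemma vsection_subset_atMost: "A \<subseteq> Delta \<Longrightarrow> vsection A n \<subseteq> {..n}"
  by (auto simp: vsection_def Delta_def)

lemma finite_vsection: "A \<subseteq> Delta \<Longrightarrow> finite (vsection A n)"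
  by (rule finite_subset[OF vsection_subset_atMost]) simp_all

lemma finite_Delta_Int_fst_less: "finite {x \<in> Delta. fst x < m}"
proof (rule finite_subset)
  show "{x \<in> Delta. fst x < m} \<subseteq> {..<m} \<times> {..<m}" by (auto simp: Delta_def)
qed simp

text \<open>Columns of \<open>Delta\<close> are finite, so a subset of \<open>Delta\<close> is
  finite iff it meets only finitely many columns.\<close>

lemma almost_subset_iff_eventually_vsection:
  assumes "A \<subseteq> Delta"
  shows "A \<subseteq>* B \<longleftrightarrow> (\<forall>\<^sub>F n in sequentially. vsection A n \<subseteq> vsection B n)"
proof
  assume "A \<subseteq>* B"
  then have "finite (fst ` (A - B))" by (simp add: almost_subset_def)
  then obtain m where m: "\<forall>n\<in>fst ` (A - B). n < m" by (meson finite_nat_set_iff_bounded)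
  have "vsection A n \<subseteq> vsection B n" if "n \<ge> m" for n
    using m that by (force simp: vsection_def)
  then show "\<forall>\<^sub>F n in sequentially. vsection A n \<subseteq> vsection B n"
    using eventually_sequentially by blast
next
  assume "\<forall>\<^sub>F n in sequentially. vsection A n \<subseteq> vsection B n"
  then obtain m where m: "\<And>n. n \<ge> m \<Longrightarrow> vsection A n \<subseteq> vsection B n"
    by (auto simp: eventually_sequentially)
  have "A - B \<subseteq> {x \<in> Delta. fst x < m}"
  proof
    fix x assume x: "x \<in> A - B"
    then have "\<not> vsection A (fst x) \<subseteq> vsection B (fst x)" by (cases x) (auto simp: vsection_def)
    then have "fst x < m" using m not_le by blast
    then show "x \<in> {x \<in> Delta. fst x < m}" using x assms by blast
  qed
  then show "A \<subseteq>* B"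
    unfolding almost_subset_def using finite_Delta_Int_fst_less by (rule finite_subset)
qed

lemma eventually_card_vsection_le_column_rank:
  assumes "A \<in> ED_fin"
  shows "\<forall>\<^sub>F n in sequentially. card (vsection A n) \<le> column_rank A"
proof -
  obtain N where "\<forall>\<^sub>F n in sequentially. ecard (vsection A n) \<le> enat N"
    using assms by (auto simp: ED_fin_def ED_iff)
  then have "\<forall>\<^sub>F n in sequentially. card (vsection A n) \<le> N"
    by (rule eventually_mono) (auto simp: ecard_def split: if_splits)
  then show ?thesis unfolding column_rank_def by (rule LeastI)
qed

lemma column_rank_mono:
  assumes "A \<in> ED_fin" "B \<in> ED_fin" "A \<subseteq>* B"
  shows "column_rank A \<le> column_rank B"
proof -
  have "A \<subseteq> Delta" and B: "B \<subseteq> Delta" using assms by (auto simp: ED_fin_def)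
  then have "\<forall>\<^sub>F n in sequentially. vsection A n \<subseteq> vsection B n"
    using assms almost_subset_iff_eventually_vsection by blast
  then have "\<forall>\<^sub>F n in sequentially. card (vsection A n) \<le> column_rank B"
    using eventually_card_vsection_le_column_rank[OF assms(2)]
    by eventually_elim (meson B card_mono finite_vsection le_trans)
  then show ?thesis unfolding column_rank_def[of A] by (rule Least_le)
qed

text \<open>A positive rank lowered by one is no longer an eventual bound, by minimality; rank zero
  is trivial.\<close>

lemma frequently_card_vsection_ge_column_rank:
  "\<exists>\<^sub>F n in sequentially. card (vsection A n) \<ge> column_rank A"
proof (cases "column_rank A")
  case (Suc N)
  have "\<not> (\<forall>\<^sub>F n in sequentially. card (vsection A n) \<le> N)"
  proof
    assume "\<forall>\<^sub>F n in sequentially. card (vsection A n) \<le> N"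
    then have "column_rank A \<le> N" unfolding column_rank_def by (rule Least_le)
    then show False using Suc by simp
  qed
  then show ?thesis by (simp add: Suc frequently_def not_le less_Suc_eq_le)
qed simp

text \<open>Otherwise \<open>Delta\<close> would be the union of two members of a proper
  ideal.\<close>

lemma infinite_Delta_diff:
  assumes "A \<in> ED_fin"
  shows "infinite (Delta - A)"
proof
  assume "finite (Delta - A)"
  then have "A \<union> (Delta - A) \<in> ED_fin"
    using assms ideal_ED_fin unfolding ideal_on_def by blast
  moreover have "A \<union> (Delta - A) = Delta" using assms by (auto simp: ED_fin_def)
  ultimately show False using ideal_ED_fin by (simp add: ideal_on_def)
qed

lemma ED_fin_UN:
  assumes "finite I" "\<And>i. i \<in> I \<Longrightarrow> B i \<in> ED_fin"
  shows "(\<Union>i\<in>I. B i) \<in> ED_fin"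
  using assms
proof (induction I rule: finite_induct)
  case empty
  then show ?case using ideal_ED_fin by (simp add: ideal_on_def)
next
  case (insert i I)
  then show ?case using ideal_ED_fin by (simp add: ideal_on_def)
qed

text \<open>Diagonalization: the point \<open>x n\<close> avoids \<open>B 0\<close>, ...,
  \<open>B n\<close>, so \<open>B i\<close> can contain \<open>x n\<close> only for
  \<open>n < i\<close>.\<close>

lemma ED_fin_sequence_almost_disjoint:
  fixes B :: "nat \<Rightarrow> (nat \<times> nat) set"
  assumes B: "\<And>i. B i \<in> ED_fin"
  shows "\<exists>X \<subseteq> Delta. infinite X \<and> (\<forall>i. finite (X \<inter> B i))"
proof -
  \<comment> \<open>Choosing \<open>x n\<close> in a column beyond \<open>n\<close> or equal to it
    keeps the range of \<open>x\<close> infinite. Such a point exists because the first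
    \<open>n\<close> columns of \<open>Delta\<close> are finite.\<close>
  have "\<exists>x \<in> Delta - (\<Union>i\<le>n. B i). fst x \<ge> n" for n
  proof -
    have "infinite (Delta - (\<Union>i\<le>n. B i))" by (intro infinite_Delta_diff ED_fin_UN B) simp
    then have "\<not> Delta - (\<Union>i\<le>n. B i) \<subseteq> {x \<in> Delta. fst x < n}"
      using finite_subset finite_Delta_Int_fst_less by blast
    then show ?thesis by force
  qed
  then obtain x where x: "\<And>n. x n \<in> Delta - (\<Union>i\<le>n. B i)" and ge: "\<And>n. fst (x n) \<ge> n"
    by metis
  have "infinite (range x)"
  proof
    assume "finite (range x)"
    then have "finite (fst ` range x)" by (rule finite_imageI)
    then obtain m where "\<forall>n\<in>fst ` range x. n < m" by (meson finite_nat_set_iff_bounded)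
    then have "fst (x m) < m" by blast
    then show False using ge[of m] by simp
  qed
  moreover have "finite (range x \<inter> B i)" for i
  proof (rule finite_subset)
    show "range x \<inter> B i \<subseteq> x ` {..<i}"
    proof
      fix y assume "y \<in> range x \<inter> B i"
      then obtain n where n: "y = x n" "x n \<in> B i" by blast
      then have "\<not> i \<le> n" using x[of n] by blast
      then show "y \<in> x ` {..<i}" using n by simp
    qed
  qed simp
  moreover have "range x \<subseteq> Delta" using x by blast
  ultimately show ?thesis by blast
qed

lemma finite_Int_almost_subset:
  assumes "A \<subseteq>* B" "finite (X \<inter> B)"
  shows "finite (X \<inter> A)"
proof (rule finite_subset)
  show "X \<inter> A \<subseteq> (A - B) \<union> (X \<inter> B)" by blast
qed (use assms in \<open>auto simp: almost_subset_def\<close>)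

lemma ED_fin_almost_disjoint_from_maximal_rank:
  assumes A: "A \<in> ED_fin"
  shows "\<exists>X \<subseteq> Delta. infinite X \<and> finite (X \<inter> A) \<and>
    (\<forall>B \<in> ED_fin. A \<subseteq>* B \<and> column_rank B \<le> column_rank A \<longrightarrow> finite (X \<inter> B))"
proof -
  \<comment> \<open>From some column on, \<open>A\<close> has at most \<open>column_rank A\<close>
    points, so for almost all members of \<open>S\<close> the inequality is an equality.\<close>
  define S where "S = {n. card (vsection A n) \<ge> column_rank A}"
  define X where "X = {x \<in> Delta - A. fst x \<in> S}"
  have AD: "A \<subseteq> Delta" and XD: "X \<subseteq> Delta" using A by (auto simp: ED_fin_def X_def)
  have "\<exists>\<^sub>F n in sequentially. n \<in> fst ` X"
  proof -
    \<comment> \<open>Column \<open>n\<close> of \<open>Delta\<close> has \<open>n + 1\<close>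
      points, more than the rank once \<open>n\<close> is large, so \<open>A\<close> leaves room
      there.\<close>
    have ev: "\<forall>\<^sub>F n in sequentially. card (vsection A n) < card {..n}"
      using eventually_card_vsection_le_column_rank[OF A] eventually_ge_at_top[of "column_rank A"]
      by eventually_elim simp
    have "\<exists>\<^sub>F n in sequentially. n \<in> S"
      using frequently_card_vsection_ge_column_rank by (simp add: S_def)
    then have "\<exists>\<^sub>F n in sequentially. n \<in> S \<and> card (vsection A n) < card {..n}"
      using ev by (rule frequently_eventually_frequently)
    then show ?thesis
    proof (rule frequently_elim1)
      fix n assume n: "n \<in> S \<and> card (vsection A n) < card {..n}"
      then have "\<not> {..n} \<subseteq> vsection A n"
        using card_mono[OF finite_vsection[OF AD]] leD by blast
      then obtain k where "k \<le> n" "(n, k) \<notin> A" by (auto simp: vsection_def)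
      then have "(n, k) \<in> X" using n by (auto simp: X_def Delta_def)
      then show "n \<in> fst ` X" by force
    qed
  qed
  then have "infinite (fst ` X)"
    by (simp add: frequently_cofinite flip: cofinite_eq_sequentially)
  then have "infinite X" by blast
  moreover have "X \<inter> A = {}" by (auto simp: X_def)
  moreover have "finite (X \<inter> B)"
    if B: "B \<in> ED_fin" "A \<subseteq>* B" "column_rank B \<le> column_rank A" for B
  proof -
    have BD: "B \<subseteq> Delta" using B by (auto simp: ED_fin_def)
    have "\<forall>\<^sub>F n in sequentially. vsection A n \<subseteq> vsection B n"
      using B AD almost_subset_iff_eventually_vsection by blast
    then have "\<forall>\<^sub>F n in sequentially. vsection (X \<inter> B) n \<subseteq> vsection {} n"
      using eventually_card_vsection_le_column_rank[OF B(1)]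
    proof eventually_elim
      case (elim n)
      \<comment> \<open>In columns from \<open>S\<close> the column of \<open>B\<close> contains
        that of \<open>A\<close> and has at most \<open>column_rank B \<le> column_rank A\<close>
        points, hence is no larger.\<close>
      have "vsection A n = vsection B n" if "n \<in> S"
        using that elim B(3) by (intro card_seteq finite_vsection BD) (auto simp: S_def)
      then show ?case by (auto simp: X_def vsection_def)
    qed
    moreover have "X \<inter> B \<subseteq> Delta" using XD by blast
    ultimately have "X \<inter> B \<subseteq>* {}" using almost_subset_iff_eventually_vsection by blast
    then show ?thesis by (simp add: almost_subset_def)
  qed
  ultimately show ?thesis using XD by (intro exI[of _ X]) auto
qed

text \<open>For a cotower, the set \<open>X\<close> obtained from its range is the forbidden
  pseudointersection of the complements.\<close>

lemma ED_fin_chain_almost_disjoint: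
  assumes C: "\<C> \<subseteq> ED_fin"
    and chain: "\<And>A B. A \<in> \<C> \<Longrightarrow> B \<in> \<C> \<Longrightarrow> A \<subseteq>* B \<or> B \<subseteq>* A"
  shows "\<exists>X \<subseteq> Delta. infinite X \<and> (\<forall>A\<in>\<C>. finite (X \<inter> A))"
\<comment> \<open>\<open>Max\<close> requires a nonempty set of ranks, so the empty chain is left to
  the second case.\<close>
proof (cases "\<C> \<noteq> {} \<and> finite (column_rank ` \<C>)")
  case True
  then obtain A where A: "A \<in> \<C>" "column_rank A = Max (column_rank ` \<C>)"
    by (metis (no_types, lifting) Max_in image_iff image_is_empty)
  then have max: "column_rank B \<le> column_rank A" if "B \<in> \<C>" for B
    using True that by simp
  from A C obtain X where X: "X \<subseteq> Delta" "infinite X" "finite (X \<inter> A)"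
      and up: "\<forall>B \<in> ED_fin. A \<subseteq>* B \<and> column_rank B \<le> column_rank A \<longrightarrow> finite (X \<inter> B)"
    using ED_fin_almost_disjoint_from_maximal_rank[of A] by blast
  have "finite (X \<inter> B)" if "B \<in> \<C>" for B
    using chain[OF A(1) that]
  proof
    assume "A \<subseteq>* B"
    then show ?thesis using up subsetD[OF C that] max[OF that] by simp
  next
    assume "B \<subseteq>* A"
    then show ?thesis using X(3) by (rule finite_Int_almost_subset)
  qed
  then show ?thesis using X by blast
next
  case False
  show ?thesis
  proof (cases "\<C> = {}")
    case True
    have "infinite Delta"
      using infinite_Delta_diff[of "{}"] ideal_ED_fin by (simp add: ideal_on_def)
    then show ?thesis using True by blast
  next
    case ne: False
    then have "infinite (column_rank ` \<C>)" using False by blast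
    then have "\<forall>n. \<exists>A\<in>\<C>. n < column_rank A" by (auto simp: infinite_nat_iff_unbounded)
    then obtain B where B: "\<And>n. B n \<in> \<C>" and gt: "\<And>n. n < column_rank (B n)" by metis
    from B C have "\<And>n. B n \<in> ED_fin" by blast
    then obtain X where X: "X \<subseteq> Delta" "infinite X" "\<And>n. finite (X \<inter> B n)"
      using ED_fin_sequence_almost_disjoint[of B] by blast
    have "finite (X \<inter> A)" if A: "A \<in> \<C>" for A
    proof -
      \<comment> \<open>The index \<open>column_rank A\<close> selects a member of rank above that
        of \<open>A\<close>; by monotonicity it cannot lie almost inside \<open>A\<close>, so
        comparability gives the converse.\<close>
      have "\<not> B (column_rank A) \<subseteq>* A"
        using column_rank_mono[of "B (column_rank A)" A] gt[of "column_rank A"] A B C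
        by (meson leD subsetD)
      then have "A \<subseteq>* B (column_rank A)" using chain A B by blast
      then show ?thesis using X(3) by (rule finite_Int_almost_subset)
    qed
    then show ?thesis using X by blast
  qed
qed

theorem mainTheorem1:
  shows "\<not> (\<exists>(\<kappa> :: 'k rel) (A :: 'k \<Rightarrow> (nat \<times> nat) set). cotower Delta ED_fin \<kappa> A)"
proof clarify
  fix \<kappa> :: "'k rel" and A :: "'k \<Rightarrow> (nat \<times> nat) set"
  assume "cotower Delta ED_fin \<kappa> A"
  then have ED: "A ` Field \<kappa> \<subseteq> ED_fin" and card: "Card_order \<kappa>"
    and dec: "\<And>\<alpha> \<beta>. (\<alpha>, \<beta>) \<in> \<kappa> \<Longrightarrow> Delta - A \<beta> \<subseteq>* Delta - A \<alpha>"
    and no_pseudo: "\<not> (\<exists>X. pseudointersection Delta \<kappa> (\<lambda>\<alpha>. Delta - A \<alpha>) X)"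
    by (auto simp: cotower_def tower_def)
  have sub: "A \<alpha> \<subseteq> Delta" if "\<alpha> \<in> Field \<kappa>" for \<alpha>
    using ED that by (auto simp: ED_fin_def)
  have inc: "A \<alpha> \<subseteq>* A \<beta>" if "(\<alpha>, \<beta>) \<in> \<kappa>" for \<alpha> \<beta>
  proof -
    have "A \<alpha> - A \<beta> = (Delta - A \<beta>) - (Delta - A \<alpha>)"
      using sub[of \<alpha>] that by (auto simp: Field_def)
    then show ?thesis using dec[OF that] by (simp add: almost_subset_def)
  qed
  have "Total \<kappa>" and "Refl \<kappa>"
    using card by (auto simp: card_order_on_def well_order_on_def linear_order_on_def
        partial_order_on_def preorder_on_def)
  \<comment> \<open>\<open>Total\<close> compares only distinct indices; for equal ones the
    difference is empty.\<close>
  then have "A \<alpha> \<subseteq>* A \<beta> \<or> A \<beta> \<subseteq>* A \<alpha>" if "\<alpha> \<in> Field \<kappa>" "\<beta> \<in> Field \<kappa>" for \<alpha> \<beta>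
    using that inc by (cases "\<alpha> = \<beta>") (auto simp: total_on_def almost_subset_def)
  then have "\<exists>X \<subseteq> Delta. infinite X \<and> (\<forall>B \<in> A ` Field \<kappa>. finite (X \<inter> B))"
    by (intro ED_fin_chain_almost_disjoint[OF ED]) auto
  then obtain X where X: "X \<subseteq> Delta" "infinite X" "\<forall>B \<in> A ` Field \<kappa>. finite (X \<inter> B)"
    by (elim exE conjE)
  \<comment> \<open>Almost inclusion of \<open>X\<close> in a complement thus means finite
    intersection with \<open>A \<alpha>\<close>.\<close>
  have "X - (Delta - A \<alpha>) = X \<inter> A \<alpha>" for \<alpha> using X(1) by blast
  then have "pseudointersection Delta \<kappa> (\<lambda>\<alpha>. Delta - A \<alpha>) X"
    using X by (simp add: pseudointersection_def almost_subset_def)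
  then show False using no_pseudo by blast
qed

end
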